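(* Let $R$ be an integral domain of characteristic $2$ and $(M,\ast)$ a generalized symplectic quandle over $R$. If the underlying module $M$ is torsion-free, then there exists a bijection $$\operatorname{Good}(M,\ast)\cong\operatorname{Inv}(\operatorname{rad}(M)).$$ In particular, if the bilinear form $\langle\cdot,\cdot\rangle$ is nondegenerate, then $\operatorname{Good}(M,\ast)=\{\mathrm{id}_M\}$.
   Context: A quandle is a set $Q$ with a binary operation $\ast$ such that $x\ast x=x$; each map $s_y\colon x\mapsto x\ast y$ is invertible; and $(x\ast y)\ast z=(x\ast z)\ast(y\ast z)$. Write $x\ast^{-1}y:=s_y^{-1}(x)$. An involution on a set is a self-map $\rho$ with $\rho\circ\rho=\mathrm{id}$; $\operatorname{Inv}(S)$ is the set of all involutions on a set $S$. A good involution on $(Q,\ast)$ is an involution $\rho$ with $\rho(x\ast y)=\rho(x)\ast y$ and $x\ast\rho(y)=x\ast^{-1}y$ for all $x,y\in Q$; $\operatorname{Good}(Q,\ast)$ is the set of them. Let $R$ be a commutative ring with identity and $M$ an $R$-module with an antisymmetric bilinear form $\langle\cdot,\cdot\rangle\colon M\times M\to R$ satisfying $\langle x,x\rangle=0$ for all $x\in M$. The generalized symplectic quandle $(M,\ast)$ over $R$ is $M$ with $x\ast y:=x+\langle x,y\rangle y$ (so $x\ast^{-1}y=x-\langle x,y\rangle y$). The radical is $\operatorname{rad}(M)=\{x\in M\mid\langle x,y\rangle=0\text{ for all }y\in M\}$. The form is nondegenerate if the map $M\to M^\vee$, $x\mapsto\langle x,-\rangle$, to the dual module is injective, equivalently $\operatorname{rad}(M)=\{0\}$.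 *)

theory Defs
  imports Complex_Main "HOL-Library.FuncSet"
begin

locale quandle =
  fixes Q :: "'a set" and op :: "'a \<Rightarrow> 'a \<Rightarrow> 'a"
  assumes closed: "x \<in> Q \<Longrightarrow> y \<in> Q \<Longrightarrow> op x y \<in> Q"
    and idem: "x \<in> Q \<Longrightarrow> op x x = x"
    and bij: "y \<in> Q \<Longrightarrow> bij_betw (\<lambda>x. op x y) Q Q"
    and distrib: "x \<in> Q \<Longrightarrow> y \<in> Q \<Longrightarrow> z \<in> Q \<Longrightarrow>
      op (op x y) z = op (op x z) (op y z)"

definition quandle_inv_op :: "'a set \<Rightarrow> ('a \<Rightarrow> 'a \<Rightarrow> 'a) \<Rightarrow> 'a \<Rightarrow> 'a \<Rightarrow> 'a" where
  "quandle_inv_op Q op x y = inv_into Q (\<lambda>z. op z y) x"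

text \<open>Self-maps of \<open>S\<close> are taken to be extensional, so that two of them are equal as soon as
  they agree on \<open>S\<close>; for \<open>S = UNIV\<close> extensionality is no restriction.\<close>

definition involutions :: "'a set \<Rightarrow> ('a \<Rightarrow> 'a) set" where
  "involutions S = {\<rho> \<in> S \<rightarrow>\<^sub>E S. \<forall>x\<in>S. \<rho> (\<rho> x) = x}"

definition good_involutions :: "'a set \<Rightarrow> ('a \<Rightarrow> 'a \<Rightarrow> 'a) \<Rightarrow> ('a \<Rightarrow> 'a) set" where
  "good_involutions Q op = {\<rho> \<in> involutions Q. \<forall>x\<in>Q. \<forall>y\<in>Q.
     \<rho> (op x y) = op (\<rho> x) y \<and> op x (\<rho> y) = quandle_inv_op Q op x y}"

locale alternating_module = module scale
  for scale :: "'r::comm_ring_1 \<Rightarrow> 'm::ab_group_add \<Rightarrow> 'm" +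
  fixes form :: "'m \<Rightarrow> 'm \<Rightarrow> 'r"
  assumes linear_left: "module_hom scale (*) (\<lambda>x. form x y)"
    and linear_right: "module_hom scale (*) (\<lambda>y. form x y)"
    and antisymmetric: "form x y = - form y x"
    and alternating: "form x x = 0"

definition symplectic_op ::
    "('r \<Rightarrow> 'm \<Rightarrow> 'm) \<Rightarrow> ('m \<Rightarrow> 'm \<Rightarrow> 'r) \<Rightarrow> 'm::ab_group_add \<Rightarrow> 'm \<Rightarrow> 'm" where
  "symplectic_op scale form x y = x + scale (form x y) y"

definition radical :: "('m \<Rightarrow> 'm \<Rightarrow> 'r::zero) \<Rightarrow> 'm set" where
  "radical form = {x. \<forall>y. form x y = 0}"

text \<open>By bilinearity, \<open>form x\<close> lies in the dual module; injectivity of \<open>x \<mapsto> form x\<close> does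
  not depend on restricting its codomain to the dual.\<close>

definition nondegenerate :: "('m \<Rightarrow> 'm \<Rightarrow> 'r) \<Rightarrow> bool" where
  "nondegenerate form \<longleftrightarrow> inj form"

definition torsion_free :: "('r::zero \<Rightarrow> 'm::zero \<Rightarrow> 'm) \<Rightarrow> bool" where
  "torsion_free scale \<longleftrightarrow> (\<forall>r x. scale r x = 0 \<longrightarrow> r = 0 \<or> x = 0)"

context alternating_module
begin

lemma form_add_left: "form (x + y) z = form x z + form y z"
  using linear_left[of z] by (simp add: module_hom_iff)

lemma form_scale_left: "form (scale r x) z = r * form x z"
  using linear_left[of z] by (simp add: module_hom_iff)

lemma form_add_right: "form z (x + y) = form z x + form z y"
  using linear_right[of z] by (simp add: module_hom_iff)

lemma form_scale_right: "form z (scale r x) = r * form z x"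
  using linear_right[of z] by (simp add: module_hom_iff)

lemma form_diff_left: "form (x - y) z = form x z - form y z"
  using form_add_left[of "x - y" y z] by (simp add: algebra_simps)

lemma symplectic_op_right_inverse:
  "symplectic_op scale form (x - scale (form x y) y) y = x"
  by (simp add: symplectic_op_def form_diff_left form_scale_left alternating)

lemma symplectic_op_left_inverse:
  "symplectic_op scale form x y - scale (form (symplectic_op scale form x y) y) y = x"
  by (simp add: symplectic_op_def form_add_left form_scale_left alternating)

lemma symplectic_op_bij: "bij (\<lambda>x. symplectic_op scale form x y)"
  by (rule o_bij[where g = "\<lambda>x. x - scale (form x y) y"])
     (auto simp: fun_eq_iff symplectic_op_right_inverse symplectic_op_left_inverse)

lemma form_symplectic_op:
  "form (symplectic_op scale form x z) (symplectic_op scale form y z) = form x y"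
  using antisymmetric[of z y]
  by (simp add: symplectic_op_def form_add_left form_add_right form_scale_left
      form_scale_right alternating algebra_simps)

sublocale symplectic: quandle UNIV "symplectic_op scale form"
proof
  fix x y z
  let ?op = "symplectic_op scale form"
  have add: "?op (u + v) z = ?op u z + ?op v z" for u v
    by (simp add: symplectic_op_def form_add_left scale_left_distrib algebra_simps)
  have scl: "?op (scale r u) z = scale r (?op u z)" for r u
    by (simp add: symplectic_op_def form_scale_left scale_right_distrib)
  have "?op (?op x y) z = ?op x z + scale (form x y) (?op y z)"
    using add scl by (simp add: symplectic_op_def[of scale form x y])
  also have "\<dots> = ?op (?op x z) (?op y z)"
    by (simp add: symplectic_op_def[of scale form "?op x z" "?op y z"] form_symplectic_op)
  finally show "?op (?op x y) z = ?op (?op x z) (?op y z)" .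
qed (use symplectic_op_bij in \<open>auto simp: symplectic_op_def alternating\<close>)

lemma quandle_inv_op_symplectic:
  "quandle_inv_op UNIV (symplectic_op scale form) x y = x - scale (form x y) y"
  unfolding quandle_inv_op_def
  by (rule inv_f_eq[OF bij_is_inj[OF symplectic_op_bij] symplectic_op_right_inverse])

lemma nondegenerate_iff_radical: "nondegenerate form \<longleftrightarrow> radical form = {0}"
proof
  have zero: "form 0 y = 0" for y
    using form_scale_left[of 0 0 y] by simp
  assume inj: "nondegenerate form"
  show "radical form = {0}"
    using zero injD[OF inj[unfolded nondegenerate_def], of _ 0]
    by (auto simp: radical_def fun_eq_iff)
next
  assume rad: "radical form = {0}"
  show "nondegenerate form"
    unfolding nondegenerate_def
  proof (rule injI)
    fix x y assume "form x = form y"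
    then have "x - y \<in> radical form"
      by (simp add: radical_def form_diff_left)
    with rad show "x = y" by simp
  qed
qed

end

end

theory Submission
  imports Defs
begin

text \<open>The second axiom of a good involution says \<open>\<langle>x, \<rho> y\<rangle> \<rho> y = - \<langle>x, y\<rangle> y\<close> for all \<open>x\<close>, and in
  characteristic 2 the sign disappears. Pairing this identity once more with \<open>x\<close> gives
  \<open>\<langle>x, \<rho> y\<rangle>\<^sup>2 = \<langle>x, y\<rangle>\<^sup>2\<close>, so \<open>\<langle>x, \<rho> y\<rangle> = \<langle>x, y\<rangle>\<close> because squaring is injective on a domain of
  characteristic 2. If \<open>y\<close> lies outside the radical, some \<open>\<langle>x, y\<rangle>\<close> is nonzero and can be cancelled
  from \<open>\<langle>x, y\<rangle> \<rho> y = \<langle>x, y\<rangle> y\<close>, whence \<open>\<rho> y = y\<close>; if \<open>y\<close> lies in the radical, so does \<open>\<rho> y\<close>.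
  A good involution is therefore the identity off the radical and an involution on it.

  Conversely, translating by a radical element does nothing, radical elements are fixed by every
  translation, and translations preserve the complement of the radical. So the first axiom holds for
  every involution of the radical extended by the identity, and the second holds because every
  translation is its own inverse in characteristic 2. Restriction to the radical is thus
  a bijection (\<open>good_involution_iff\<close>, \<open>bij_betw_restrict_radical\<close>), and a radical \<open>{0}\<close> leaves only
  the identity.\<close>

locale torsion_free_char2_module = alternating_module scale form
  for scale :: "'r::idom \<Rightarrow> 'm::ab_group_add \<Rightarrow> 'm" and form :: "'m \<Rightarrow> 'm \<Rightarrow> 'r" +
  assumes char_two: "CHAR('r) = 2"
    and torsion_free: "torsion_free scale"
begin

abbreviation "op \<equiv> symplectic_op scale form"

lemma ring_uminus_eq: "- a = a" for a :: 'r
proof -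
  have "(2 :: 'r) = of_nat CHAR('r)"
    by (simp add: char_two)
  then have "a + a = 0"
    by (simp only: of_nat_CHAR mult_2[symmetric] mult_zero_left)
  then show ?thesis
    by (rule minus_unique)
qed

lemma form_commute: "form x y = form y x"
  using antisymmetric[of x y] by (simp add: ring_uminus_eq)

lemma inv_op_eq_op: "quandle_inv_op UNIV op x y = op x y"
  using scale_minus_left[of "form x y" y]
  by (simp add: quandle_inv_op_symplectic symplectic_op_def ring_uminus_eq)

lemma radical_iff: "y \<in> radical form \<longleftrightarrow> (\<forall>x. form x y = 0)"
  using form_commute by (auto simp: radical_def)

lemma op_radical_right: "y \<in> radical form \<Longrightarrow> op x y = x"
  by (simp add: radical_iff symplectic_op_def)

lemma op_radical_left: "x \<in> radical form \<Longrightarrow> op x y = x"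
  by (simp add: radical_def symplectic_op_def)

text \<open>A translation by \<open>y\<close> leaves the pairing with \<open>y\<close> unchanged, so if it moves \<open>x\<close> into the
  radical then \<open>\<langle>x, y\<rangle> = 0\<close> and \<open>x\<close> was not moved at all.\<close>

lemma op_in_radical_iff: "op x y \<in> radical form \<longleftrightarrow> x \<in> radical form"
proof
  assume rad: "op x y \<in> radical form"
  then have "form (op x y) y = 0"
    by (simp add: radical_def)
  then have "form x y = 0"
    by (simp add: symplectic_op_def form_add_left form_scale_left alternating)
  then have "op x y = x"
    by (simp add: symplectic_op_def)
  with rad show "x \<in> radical form"
    by simp
qed (simp add: op_radical_left)

text \<open>Pairing \<open>\<langle>x, z\<rangle> z = \<langle>x, y\<rangle> y\<close> with \<open>x\<close> and taking the unique square roots of characteristic 2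
  equates the coefficients; off the radical, \<open>x\<close> can be chosen to make them nonzero, and torsion-freeness
  cancels them.\<close>

lemma same_translation_imp_eq:
  assumes same: "\<And>x. op x z = op x y" and y: "y \<notin> radical form"
  shows "z = y"
proof -
  obtain x where nz: "form x y \<noteq> 0"
    using y radical_iff by blast
  have eq: "scale (form x z) z = scale (form x y) y"
    using same[of x] by (simp add: symplectic_op_def)
  have "form x z * form x z = form x y * form x y"
    using arg_cong[OF eq, of "form x"] by (simp add: form_scale_right)
  then have "form x z = form x y"
    by (simp add: square_eq_iff ring_uminus_eq)
  with eq have "scale (form x y) (z - y) = 0"
    by (simp add: scale_right_diff_distrib)
  with torsion_free nz have "z - y = 0"
    unfolding torsion_free_def by blast
  then show "z = y"
    by simp
qed

lemma same_translation_radical: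
  assumes same: "\<And>x. op x z = op x y" and y: "y \<in> radical form"
  shows "z \<in> radical form"
proof -
  have "scale (form x z) z = 0" for x
    using same[of x] y by (simp add: op_radical_right) (simp add: symplectic_op_def)
  then have "z = 0 \<or> (\<forall>x. form x z = 0)"
    using torsion_free by (auto simp: torsion_free_def)
  moreover have "form x 0 = 0" for x
    using form_scale_right[of x 0 0] by simp
  ultimately show ?thesis
    by (auto simp: radical_iff)
qed

lemma good_involution_iff:
  "\<rho> \<in> good_involutions UNIV op \<longleftrightarrow>
     restrict \<rho> (radical form) \<in> involutions (radical form) \<and>
     (\<forall>x. x \<notin> radical form \<longrightarrow> \<rho> x = x)"
proof
  assume "\<rho> \<in> good_involutions UNIV op"
  then have same: "op x (\<rho> y) = op x y" and invol: "\<rho> (\<rho> x) = x" for x y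
    by (auto simp: good_involutions_def involutions_def inv_op_eq_op)
  have "\<rho> y = y" if "y \<notin> radical form" for y
    using same that by (rule same_translation_imp_eq)
  moreover have "\<rho> y \<in> radical form" if "y \<in> radical form" for y
    using same that by (rule same_translation_radical)
  ultimately show "restrict \<rho> (radical form) \<in> involutions (radical form) \<and>
      (\<forall>x. x \<notin> radical form \<longrightarrow> \<rho> x = x)"
    using invol by (simp add: involutions_def)
next
  assume *: "restrict \<rho> (radical form) \<in> involutions (radical form) \<and>
      (\<forall>x. x \<notin> radical form \<longrightarrow> \<rho> x = x)"
  then have off: "\<rho> x = x" if "x \<notin> radical form" for x
    using that by blast
  have on: "\<rho> x \<in> radical form" if "x \<in> radical form" for x
    using * that by (auto simp: involutions_def PiE_iff)
  have "\<rho> (\<rho> x) = x" if "x \<in> radical form" for x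
    using * that on[OF that] by (auto simp: involutions_def)
  with off have "\<rho> (\<rho> x) = x" for x
    by (cases "x \<in> radical form") auto
  moreover have "\<rho> (op x y) = op (\<rho> x) y" for x y
    using off on op_in_radical_iff[of x y]
    by (cases "x \<in> radical form") (simp_all add: op_radical_left)
  moreover have "op x (\<rho> y) = op x y" for x y
    using off on by (cases "y \<in> radical form") (simp_all add: op_radical_right)
  ultimately show "\<rho> \<in> good_involutions UNIV op"
    by (simp add: good_involutions_def involutions_def inv_op_eq_op)
qed

lemma bij_betw_restrict_radical:
  "bij_betw (\<lambda>\<rho>. restrict \<rho> (radical form))
     (good_involutions UNIV op) (involutions (radical form))"
proof (rule bij_betw_byWitness
    [where f' = "\<lambda>\<sigma> x. if x \<in> radical form then \<sigma> x else x"])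
  show "\<forall>\<rho>\<in>good_involutions UNIV op.
      (\<lambda>x. if x \<in> radical form then restrict \<rho> (radical form) x else x) = \<rho>"
    by (auto simp: good_involution_iff)
  have extend: "restrict (\<lambda>x. if x \<in> radical form then \<sigma> x else x) (radical form) = \<sigma>"
    if "\<sigma> \<in> involutions (radical form)" for \<sigma>
    using that by (auto simp: involutions_def PiE_iff extensional_def)
  then show "\<forall>\<sigma>\<in>involutions (radical form).
      restrict (\<lambda>x. if x \<in> radical form then \<sigma> x else x) (radical form) = \<sigma>"
    by blast
  show "(\<lambda>\<rho>. restrict \<rho> (radical form)) ` good_involutions UNIV op
      \<subseteq> involutions (radical form)"
    by (auto simp: good_involution_iff)
  show "(\<lambda>\<sigma> x. if x \<in> radical form then \<sigma> x else x) ` involutions (radical form)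
      \<subseteq> good_involutions UNIV op"
    using extend by (auto simp: good_involution_iff)
qed

lemma good_involutions_nondegenerate:
  assumes "nondegenerate form"
  shows "good_involutions UNIV op = {id}"
proof -
  have rad: "radical form = {0}"
    using assms by (simp add: nondegenerate_iff_radical)
  have "restrict \<rho> {0} \<in> involutions {0} \<longleftrightarrow> \<rho> 0 = 0" for \<rho> :: "'m \<Rightarrow> 'm"
    by (auto simp: involutions_def fun_eq_iff restrict_apply split: if_splits)
  then have "\<rho> \<in> good_involutions UNIV op \<longleftrightarrow> (\<forall>x. \<rho> x = x)" for \<rho>
    unfolding good_involution_iff rad by (metis singleton_iff)
  then show ?thesis
    by (auto simp: fun_eq_iff)
qed

end

theorem corollary5p13:
  fixes scale :: "'r::idom \<Rightarrow> 'm::ab_group_add \<Rightarrow> 'm"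
    and form :: "'m \<Rightarrow> 'm \<Rightarrow> 'r"
  assumes "alternating_module scale form"
    and "CHAR('r) = 2"
    and "torsion_free scale"
  shows "(\<exists>f. bij_betw f (good_involutions UNIV (symplectic_op scale form))
                (involutions (radical form))) \<and>
    (nondegenerate form \<longrightarrow> good_involutions UNIV (symplectic_op scale form) = {id})"
proof -
  interpret torsion_free_char2_module scale form
    using assms by (simp add: torsion_free_char2_module_def torsion_free_char2_module_axioms_def)
  show ?thesis
    using bij_betw_restrict_radical good_involutions_nondegenerate by blast
qed

end
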